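(* Let $m\ge 2$, let $a_1,\ldots,a_m$ be nonnegative integers, and let $d_i$ be the degree of the vertex $x_i$ in the tree $T(a_1,\ldots,a_m)$. Define $f_0=1$, $f_1=1+\dfrac{a_1}{3d_1}$, and, for $2\le i\le m$, \[ f_i=\left(1+\frac{a_i}{3d_i}\right)f_{i-1}+\frac{1}{d_{i-1}d_i}f_{i-2}. \] Then \[ \pi(T(a_1,\ldots,a_m))=\left(\frac32\right)^{a_1+\cdots+a_m}f_m. \]
   Context: All graphs are finite and simple. For a graph $G$, $d(v)$ denotes the degree of a vertex $v$, and $L(G)=D(G)-A(G)$ is the Laplacian matrix, where $A(G)$ is the adjacency matrix and $D(G)$ is the diagonal matrix of degrees. The permanent of an $n\times n$ matrix $M=(m_{ij})$ is $\operatorname{per}(M)=\sum_{\sigma\in S_n}\prod_{i=1}^n m_{i,\sigma(i)}$. If $G$ has no isolated vertices, its Laplacian ratio is $\pi(G)=\operatorname{per}(L(G))/\prod_{v\in V(G)}d(v)$. For $m\ge 2$ and nonnegative integers $a_1,\ldots,a_m$, the tree $T(a_1,\ldots,a_m)$ is obtained from the path $x_1-x_2-\cdots-x_m$ by attaching, for each $i$, exactly $a_i$ pendant paths of length two to the vertex $x_i$; that is, each attached path has the form $x_i-y-z$ with new vertices $y,z$, where $y$ is adjacent exactly to $x_i$ and $z$, and $z$ is a leaf. Thus $x_i$ has degree $a_i+1$ if $i\in\{1,m\}$ and $a_i+2$ if $1<i<m$. *)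

theory Defs
  imports Complex_Main "HOL-Combinatorics.Permutations" "Graph_Theory.Pair_Digraph"
begin

text \<open>
  A finite simple graph is a \<^const>\<open>pair_graph\<close>: a finite, loop-free, symmetric set of
  arcs, each undirected edge being represented by its two orientations.  The degree of a vertex
  is therefore its out-degree.
\<close>

definition degree :: "'a pair_pre_digraph \<Rightarrow> 'a \<Rightarrow> nat" where
  "degree G v = out_degree (with_proj G) v"

text \<open>Square matrices indexed by the vertex set are functions of two vertices.\<close>

definition adjacency_matrix :: "'a pair_pre_digraph \<Rightarrow> 'a \<Rightarrow> 'a \<Rightarrow> real" where
  "adjacency_matrix G u v = (if (u, v) \<in> parcs G then 1 else 0)"

definition degree_matrix :: "'a pair_pre_digraph \<Rightarrow> 'a \<Rightarrow> 'a \<Rightarrow> real" where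
  "degree_matrix G u v = (if u = v then real (degree G u) else 0)"

definition laplacian :: "'a pair_pre_digraph \<Rightarrow> 'a \<Rightarrow> 'a \<Rightarrow> real" where
  "laplacian G u v = degree_matrix G u v - adjacency_matrix G u v"

definition permanent :: "'a set \<Rightarrow> ('a \<Rightarrow> 'a \<Rightarrow> real) \<Rightarrow> real" where
  "permanent V M = (\<Sum>p | p permutes V. \<Prod>v\<in>V. M v (p v))"

text \<open>
  Only meaningful for graphs without isolated vertices, as otherwise the denominator is zero.
\<close>

definition laplacian_ratio :: "'a pair_pre_digraph \<Rightarrow> real" where
  "laplacian_ratio G =
     permanent (pverts G) (laplacian G) / (\<Prod>v\<in>pverts G. real (degree G v))"

text \<open>
  \<open>X i\<close> is the path vertex \<open>x\<^sub>i\<close>; the \<open>j\<close>-th pendant path attached to it is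
  \<open>X i - Y i j - Z i j\<close>, for \<open>1 \<le> j \<le> a i\<close>.
\<close>

datatype tvertex = X nat | Y nat nat | Z nat nat

definition T_edges :: "nat \<Rightarrow> (nat \<Rightarrow> nat) \<Rightarrow> (tvertex \<times> tvertex) set" where
  "T_edges m a =
     {(X i, X (i + 1)) | i. 1 \<le> i \<and> i < m}
   \<union> {(X i, Y i j) | i j. i \<in> {1..m} \<and> j \<in> {1..a i}}
   \<union> {(Y i j, Z i j) | i j. i \<in> {1..m} \<and> j \<in> {1..a i}}"

definition T :: "nat \<Rightarrow> (nat \<Rightarrow> nat) \<Rightarrow> tvertex pair_pre_digraph" where
  "T m a =
     \<lparr> pverts = {X i | i. i \<in> {1..m}}
        \<union> {Y i j | i j. i \<in> {1..m} \<and> j \<in> {1..a i}}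
        \<union> {Z i j | i j. i \<in> {1..m} \<and> j \<in> {1..a i}},
       parcs = T_edges m a \<union> (T_edges m a)\<inverse> \<rparr>"

lemma finite_T_verts: "finite (pverts (T m a))"
proof -
  have "pverts (T m a) = X ` {1..m} \<union> (\<Union>i\<in>{1..m}. Y i ` {1..a i})
      \<union> (\<Union>i\<in>{1..m}. Z i ` {1..a i})"
    by (auto simp: T_def)
  then show ?thesis by simp
qed

lemma pair_graph_T: "pair_graph (T m a)"
proof -
  have sub: "parcs (T m a) \<subseteq> pverts (T m a) \<times> pverts (T m a)"
    by (auto simp: T_def T_edges_def)
  have fin: "finite (parcs (T m a))"
    using finite_subset[OF sub] finite_T_verts by blast
  show ?thesis
  proof unfold_locales
    show "symmetric (with_proj (T m a))"
      by (auto simp: symmetric_def T_def sym_def)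
    show "fst e \<noteq> snd e" if "e \<in> parcs (T m a)" for e
      using that by (auto simp: T_def T_edges_def)
  qed (use sub fin finite_T_verts in auto)
qed

lemma degree_eq_card: "degree G v = card {w. (v, w) \<in> parcs G}"
proof -
  have "out_arcs (with_proj G) v = Pair v ` {w. (v, w) \<in> parcs G}"
    by (auto simp: out_arcs_def)
  then show ?thesis
    by (simp add: degree_def out_degree_def card_image inj_on_def)
qed

lemma degree_T_X:
  assumes "m \<ge> 2" "i \<in> {1..m}"
  shows "degree (T m a) (X i) = a i + (if i = 1 \<or> i = m then 1 else 2)"
proof -
  let ?N = "(if i = 1 then {X 2} else if i = m then {X (m - 1)} else {X (i - 1), X (i + 1)})"
  have "{w. (X i, w) \<in> parcs (T m a)} = ?N \<union> Y i ` {1..a i}"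
  proof (rule set_eqI)
    fix w
    show "w \<in> {w. (X i, w) \<in> parcs (T m a)} \<longleftrightarrow> w \<in> ?N \<union> Y i ` {1..a i}"
      using assms by (cases w) (auto simp: T_def T_edges_def)
  qed
  moreover have "card (?N \<union> Y i ` {1..a i}) = card ?N + card (Y i ` {1..a i})"
    by (rule card_Un_disjoint) auto
  moreover have "card (Y i ` {1..a i}) = a i"
    by (simp add: card_image inj_on_def)
  ultimately show ?thesis
    by (simp add: degree_eq_card)
qed

lemma T_no_isolated:
  assumes "m \<ge> 2" "v \<in> pverts (T m a)"
  shows "degree (T m a) v > 0"
proof -
  interpret pair_graph "T m a" by (rule pair_graph_T)
  have "\<exists>w. (v, w) \<in> parcs (T m a)"
  proof (cases v)
    case (X i)
    have "i \<in> {1..m}" using assms X by (auto simp: T_def)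
    then have "(X i, if i < m then X (i + 1) else X (m - 1)) \<in> parcs (T m a)"
      using assms(1) by (auto simp: T_def T_edges_def)
    then show ?thesis using X by blast
  qed (use assms in \<open>auto simp: T_def T_edges_def\<close>)
  then obtain w where "(v, w) \<in> parcs (T m a)" ..
  moreover have "finite {w. (v, w) \<in> parcs (T m a)}"
    by (rule finite_subset[OF _ finite_T_verts[of m a]]) (auto dest: in_arcsD2)
  ultimately show ?thesis
    by (auto simp: degree_eq_card card_gt_0_iff)
qed

end

theory Submission
  imports Defs
begin

text \<open>
  Dividing every row of the Laplacian by the degree of its vertex turns the Laplacian ratio into
  the permanent of a matrix with unit diagonal, whose entry at an arc \<open>(u, v)\<close> is minus the
  inverse of the degree of \<open>u\<close>.  The proof rests on one property of permanents
  (\<open>permanent_cut_edge\<close>): if a vertex set splits into two parts joined by a single edge \<open>{x, y}\<close>,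
  then a permutation with nonzero contribution either preserves both parts or swaps \<open>x\<close> and
  \<open>y\<close>, because whatever leaves one part must be balanced by something that comes back, and the
  only way back is the same edge.  So the permanent is the product of the permanents of the two
  parts, plus the weight \<open>M x y * M y x\<close> of the edge times the permanents of the parts without
  \<open>x\<close> and \<open>y\<close>.

  In a tree every edge is such an edge.  A pendant path alone contributes
  \<open>1 + 1/2 = 3/2\<close>, since its inner vertex has degree 2 and its leaf degree 1.  Attaching it to
  \<open>X i\<close> multiplies the permanent by \<open>3/2\<close> and adds, through the joining edge of weight
  \<open>1 / (2 * d i)\<close>, a third of \<open>1 / d i\<close> relative to that factor; hence \<open>X i\<close> with its paths has
  permanent \<open>(3/2) ^ a i * (1 + a i / (3 * d i))\<close>.  Finally, cutting the edge between \<open>X (i - 1)\<close>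
  and \<open>X i\<close> gives the two-term recursion for \<open>f\<close>: in the second term both end points are removed,
  and what remains is the tree up to \<open>X (i - 2)\<close> and the loose pendant paths at \<open>X (i - 1)\<close> and
  \<open>X i\<close>, which only contribute powers of \<open>3/2\<close>.
\<close>

section \<open>Permanents and cut edges\<close>

lemma permanent_cong:
  assumes "\<And>u v. u \<in> V \<Longrightarrow> v \<in> V \<Longrightarrow> M u v = N u v"
  shows "permanent V M = permanent V N"
  unfolding permanent_def
  by (intro sum.cong prod.cong refl) (use assms in \<open>auto simp: permutes_in_image\<close>)

lemma permanent_empty [simp]: "permanent {} M = 1"
  by (simp add: permanent_def)

lemma permanent_singleton [simp]: "permanent {v} M = M v v"
  by (simp add: permanent_def permutes_sing)

lemma inj_exit_imp_entry:
  assumes "finite B" "inj p" "x \<notin> B" "p x \<in> B"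
  obtains b where "b \<in> B" "p b \<notin> B"
proof -
  have "\<not> p ` B \<subseteq> B"
  proof
    assume "p ` B \<subseteq> B"
    then have "p ` B = B"
      using assms by (meson endo_inj_surj inj_on_subset subset_UNIV)
    then show False
      using assms by (metis imageE injD)
  qed
  then show thesis using that by blast
qed

text \<open>
  A permutation that never moves an element of \<open>A\<close> into \<open>B\<close> cannot move one of \<open>B\<close> into \<open>A\<close>
  either, so the contributing permutations are exactly the pairs of permutations of the two parts.
\<close>

lemma permanent_disjoint_blocks:
  assumes fin: "finite A" "finite B" and disj: "A \<inter> B = {}"
    and zero: "\<And>u v. u \<in> A \<Longrightarrow> v \<in> B \<Longrightarrow> M u v = 0"
  shows "permanent (A \<union> B) M = permanent A M * permanent B M"
proof -
  let ?w = "\<lambda>V p. \<Prod>v\<in>V. M v (p v)"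
  define S where "S = {p. p permutes A \<union> B \<and> p ` A \<subseteq> A}"
  have image_A: "p ` A = A" if "p \<in> S" for p
    using that fin(1) by (intro endo_inj_surj) (auto simp: S_def intro: permutes_inj_on)
  have image_B: "p ` B = B" if "p \<in> S" for p
  proof -
    have "inj p" "p ` (A \<union> B) = A \<union> B"
      using that by (auto simp: S_def permutes_inj permutes_image)
    moreover have "B = (A \<union> B) - A" using disj by blast
    ultimately show ?thesis
      using image_A[OF that] by (metis image_set_diff)
  qed
  have bij: "bij_betw p A A" "bij_betw p B B" if "p \<in> S" for p
    using image_A[OF that] image_B[OF that] that
    by (auto simp: bij_betw_def S_def intro: permutes_inj_on)
  have "permanent (A \<union> B) M = sum (?w (A \<union> B)) S"
    unfolding permanent_def
  proof (rule sum.mono_neutral_right)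
    show "finite {p. p permutes A \<union> B}" using fin by (simp add: finite_permutations)
    show "\<forall>p\<in>{p. p permutes A \<union> B} - S. ?w (A \<union> B) p = 0"
    proof
      fix p assume p: "p \<in> {p. p permutes A \<union> B} - S"
      then obtain u where "u \<in> A" "p u \<notin> A" by (auto simp: S_def)
      moreover from this p have "p u \<in> B" using permutes_in_image[of p "A \<union> B" u] by auto
      ultimately show "?w (A \<union> B) p = 0"
        using fin zero by (intro prod_zero) auto
    qed
  qed (auto simp: S_def)
  also have "\<dots> = (\<Sum>(p, q)\<in>{p. p permutes A} \<times> {q. q permutes B}. ?w A p * ?w B q)"
  proof (rule sum.reindex_bij_witness[where i = "\<lambda>(p, q). p \<circ> q"
        and j = "\<lambda>p. (restrict_id p A, restrict_id p B)"])
    fix p assume p: "p \<in> S"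
    then have perm: "p permutes A \<union> B" by (simp add: S_def)
    have "p v \<in> B" if "v \<in> B" for v using image_B[OF p] that by blast
    then show "(case (restrict_id p A, restrict_id p B) of (p, q) \<Rightarrow> p \<circ> q) = p"
      using disj permutes_not_in[OF perm] by (fastforce simp: restrict_id_def)
    show "(restrict_id p A, restrict_id p B) \<in> {p. p permutes A} \<times> {q. q permutes B}"
      using bij[OF p] by (auto intro: permutes_restrict_id)
    show "(case (restrict_id p A, restrict_id p B) of (p, q) \<Rightarrow> ?w A p * ?w B q) = ?w (A \<union> B) p"
      using fin disj by (simp add: prod.union_disjoint)
  next
    fix r assume "r \<in> {p. p permutes A} \<times> {q. q permutes B}"
    then obtain p q where r: "r = (p, q)" and p: "p permutes A" and q: "q permutes B" by auto
    have fix_p: "p v = v" if "v \<in> B" for v using p that disj permutes_not_in by fastforce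
    have fix_q: "q v = v" if "v \<in> A" for v using q that disj permutes_not_in by fastforce
    have "restrict_id (p \<circ> q) A = p"
      using fix_q permutes_not_in[OF p] by (auto simp: restrict_id_def)
    moreover have "restrict_id (p \<circ> q) B = q"
      using fix_p permutes_not_in[OF q] permutes_in_image[OF q] by (auto simp: restrict_id_def)
    ultimately show "(restrict_id (case r of (p, q) \<Rightarrow> p \<circ> q) A,
        restrict_id (case r of (p, q) \<Rightarrow> p \<circ> q) B) = r"
      by (simp add: r)
    have "p \<circ> q permutes A \<union> B"
      using p q by (meson permutes_compose permutes_subset sup_ge1 sup_ge2)
    then show "(case r of (p, q) \<Rightarrow> p \<circ> q) \<in> S"
      using fix_q permutes_in_image[OF p] by (auto simp: S_def r)
  qed
  also have "\<dots> = permanent A M * permanent B M"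
    by (simp add: permanent_def sum_product sum.cartesian_product)
  finally show ?thesis .
qed

text \<open>
  The permutations that swap \<open>x\<close> and \<open>y\<close> are the permutations of the remaining elements composed
  with a transposition.
\<close>

lemma sum_permutations_swapping:
  assumes "finite V" "x \<in> V" "y \<in> V" "x \<noteq> y"
  shows "(\<Sum>p | p permutes V \<and> p x = y \<and> p y = x. \<Prod>v\<in>V. M v (p v))
    = M x y * M y x * permanent (V - {x, y}) M"
proof -
  let ?t = "transpose x y"
  have "(\<Sum>p | p permutes V \<and> p x = y \<and> p y = x. \<Prod>v\<in>V. M v (p v))
    = (\<Sum>q | q permutes V - {x, y}. M x y * M y x * (\<Prod>v\<in>V - {x, y}. M v (q v)))"
  proof (rule sum.reindex_bij_witness[where i = "\<lambda>q. q \<circ> ?t" and j = "\<lambda>p. p \<circ> ?t"])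
    fix p assume "p \<in> {p. p permutes V \<and> p x = y \<and> p y = x}"
    then have p: "p permutes V" "p x = y" "p y = x" by auto
    show "p \<circ> ?t \<circ> ?t = p" by (simp add: comp_assoc)
    have "p \<circ> ?t permutes V"
      using p assms by (intro permutes_compose permutes_swap_id)
    then show "p \<circ> ?t \<in> {q. q permutes V - {x, y}}"
      using p by (auto intro!: permutes_superset[of _ V])
    have "(\<Prod>v\<in>V. M v (p v)) = M x y * (M y x * (\<Prod>v\<in>V - {x} - {y}. M v (p v)))"
      using assms p by (simp add: prod.remove[of V x] prod.remove[of "V - {x}" y])
    moreover have "V - {x} - {y} = V - {x, y}" by blast
    moreover have "(\<Prod>v\<in>V - {x, y}. M v (p v)) = (\<Prod>v\<in>V - {x, y}. M v ((p \<circ> ?t) v))"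
      by (intro prod.cong) (auto simp: transpose_def)
    ultimately show "M x y * M y x * (\<Prod>v\<in>V - {x, y}. M v ((p \<circ> ?t) v)) = (\<Prod>v\<in>V. M v (p v))"
      by (simp only: mult.assoc)
  next
    fix q assume "q \<in> {q. q permutes V - {x, y}}"
    then have q: "q permutes V - {x, y}" by simp
    then have "q permutes V" using permutes_subset by blast
    then have "q \<circ> ?t permutes V"
      using assms by (intro permutes_compose permutes_swap_id)
    moreover have "q x = x" "q y = y" using permutes_not_in[OF q] by auto
    ultimately show "q \<circ> ?t \<in> {p. p permutes V \<and> p x = y \<and> p y = x}" by simp
    show "q \<circ> ?t \<circ> ?t = q" by (simp add: comp_assoc)
  qed
  then show ?thesis by (simp add: permanent_def sum_distrib_left)
qed

text \<open>
  Splitting off the permutations that swap \<open>x\<close> and \<open>y\<close> leaves those for which erasing the entries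
  at \<open>(x, y)\<close> and \<open>(y, x)\<close> makes no difference: by \<open>inj_exit_imp_entry\<close>, one that uses just one of
  the two entries must use a vanishing entry between \<open>A\<close> and \<open>B\<close> as well.  After the erasure the
  matrix is block diagonal.
\<close>

lemma permanent_cut_edge:
  assumes fin: "finite A" "finite B" and disj: "A \<inter> B = {}" and xy: "x \<in> A" "y \<in> B"
    and zero: "\<And>u v. u \<in> A \<Longrightarrow> v \<in> B \<Longrightarrow> (u, v) \<noteq> (x, y) \<Longrightarrow> M u v = 0 \<and> M v u = 0"
  shows "permanent (A \<union> B) M = permanent A M * permanent B M
    + M x y * M y x * (permanent (A - {x}) M * permanent (B - {y}) M)"
proof -
  let ?V = "A \<union> B"
  let ?w = "\<lambda>M p. \<Prod>v\<in>?V. M v (p v)"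
  let ?P = "{p. p permutes ?V}"
  define S where "S = {p. p permutes ?V \<and> p x = y \<and> p y = x}"
  define N where "N u v = (if u \<in> A \<and> v \<in> B \<or> u \<in> B \<and> v \<in> A then 0 else M u v)" for u v
  have zero_N: "?w N p = 0" if "v \<in> ?V" "N v (p v) = 0" for p v
    using that fin by (intro prod_zero) auto
  have erase: "?w M p = ?w N p" if "p \<in> ?P - S" for p
  proof (cases "\<forall>v\<in>?V. N v (p v) = M v (p v)")
    case True
    then show ?thesis by (intro prod.cong) auto
  next
    case False
    then obtain v where v: "v \<in> ?V" "v \<in> A \<and> p v \<in> B \<or> v \<in> B \<and> p v \<in> A" "M v (p v) \<noteq> 0"
      by (auto simp: N_def split: if_splits)
    have p: "p permutes ?V" "inj p" using that by (auto simp: permutes_inj)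
    have "v = x \<and> p x = y \<or> v = y \<and> p y = x"
      using v zero by blast
    then have "\<exists>u\<in>?V. M u (p u) = 0"
    proof
      assume *: "v = x \<and> p x = y"
      then have "p y \<noteq> x" using that by (auto simp: S_def)
      obtain b where b: "b \<in> B" "p b \<notin> B"
        using inj_exit_imp_entry[of B p x] fin p * xy disj by auto
      then have "p b \<in> A" using permutes_in_image[OF p(1), of b] by auto
      then have "M b (p b) = 0" using zero[of "p b" b] b \<open>p y \<noteq> x\<close> by auto
      then show ?thesis using b by blast
    next
      assume *: "v = y \<and> p y = x"
      then have "p x \<noteq> y" using that by (auto simp: S_def)
      obtain b where b: "b \<in> A" "p b \<notin> A"
        using inj_exit_imp_entry[of A p y] fin p * xy disj by auto
      then have "p b \<in> B" using permutes_in_image[OF p(1), of b] by auto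
      then have "M b (p b) = 0" using zero[of b "p b"] b \<open>p x \<noteq> y\<close> by auto
      then show ?thesis using b by blast
    qed
    then have "?w M p = 0" using fin by (intro prod_zero) auto
    moreover have "?w N p = 0" using zero_N[of v p] v by (auto simp: N_def)
    ultimately show ?thesis by simp
  qed
  have "finite ?P" using fin by (simp add: finite_permutations)
  moreover have "S \<subseteq> ?P" by (auto simp: S_def)
  ultimately have "permanent ?V M = sum (?w M) (?P - S) + sum (?w M) S"
    unfolding permanent_def by (rule sum.subset_diff[rotated])
  also have "sum (?w M) (?P - S) = sum (?w N) (?P - S)"
    using erase by (intro sum.cong) auto
  also have "\<dots> = permanent ?V N"
    unfolding permanent_def
  proof (rule sum.mono_neutral_left)
    show "\<forall>p\<in>?P - (?P - S). ?w N p = 0"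
      using zero_N[of x] xy by (auto simp: S_def N_def)
  qed (use \<open>finite ?P\<close> in auto)
  also have "\<dots> = permanent A N * permanent B N"
    using fin disj by (intro permanent_disjoint_blocks) (auto simp: N_def)
  also have "permanent A N = permanent A M"
    using disj by (intro permanent_cong) (auto simp: N_def)
  also have "permanent B N = permanent B M"
    using disj by (intro permanent_cong) (auto simp: N_def)
  also have "sum (?w M) S = M x y * M y x * permanent (?V - {x, y}) M"
    unfolding S_def using fin xy disj by (intro sum_permutations_swapping) auto
  also have "?V - {x, y} = (A - {x}) \<union> (B - {y})" using xy disj by blast
  also have "permanent \<dots> M = permanent (A - {x}) M * permanent (B - {y}) M"
    using fin disj zero by (intro permanent_disjoint_blocks) auto
  finally show ?thesis .
qed

section \<open>The Laplacian with normalized rows\<close>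

definition random_walk_laplacian :: "'a pair_pre_digraph \<Rightarrow> 'a \<Rightarrow> 'a \<Rightarrow> real" where
  "random_walk_laplacian G u v = laplacian G u v / real (degree G u)"

lemma laplacian_ratio_eq_permanent:
  "laplacian_ratio G = permanent (pverts G) (random_walk_laplacian G)"
  by (simp add: laplacian_ratio_def permanent_def random_walk_laplacian_def prod_dividef
      sum_divide_distrib)

lemma random_walk_laplacian_diag:
  assumes "(v, v) \<notin> parcs G" "degree G v > 0"
  shows "random_walk_laplacian G v v = 1"
  using assms
  by (simp add: random_walk_laplacian_def laplacian_def degree_matrix_def adjacency_matrix_def)

lemma random_walk_laplacian_arc:
  assumes "(u, v) \<in> parcs G" "u \<noteq> v"
  shows "random_walk_laplacian G u v = - 1 / real (degree G u)"
  using assms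
  by (simp add: random_walk_laplacian_def laplacian_def degree_matrix_def adjacency_matrix_def)

lemma random_walk_laplacian_nonadjacent:
  assumes "(u, v) \<notin> parcs G" "u \<noteq> v"
  shows "random_walk_laplacian G u v = 0"
  using assms
  by (simp add: random_walk_laplacian_def laplacian_def degree_matrix_def adjacency_matrix_def)

section \<open>The trees with pendant paths of length two\<close>

lemma degree_T_Y:
  assumes "i \<in> {1..m}" "j \<in> {1..a i}"
  shows "degree (T m a) (Y i j) = 2"
proof -
  have "{w. (Y i j, w) \<in> parcs (T m a)} = {X i, Z i j}"
    using assms by (auto simp: T_def T_edges_def)
  then show ?thesis by (simp add: degree_eq_card)
qed

lemma degree_T_Z:
  assumes "i \<in> {1..m}" "j \<in> {1..a i}"
  shows "degree (T m a) (Z i j) = 1"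
proof -
  have "{w. (Z i j, w) \<in> parcs (T m a)} = {Y i j}"
    using assms by (auto simp: T_def T_edges_def)
  then show ?thesis by (simp add: degree_eq_card)
qed

text \<open>
  Only the first \<open>n\<close> pendant paths are taken, so that they can be attached to \<open>X i\<close> one at a time.
\<close>

definition legs :: "nat \<Rightarrow> nat \<Rightarrow> tvertex set" where
  "legs i n = Y i ` {1..n} \<union> Z i ` {1..n}"

definition tree_prefix :: "(nat \<Rightarrow> nat) \<Rightarrow> nat \<Rightarrow> tvertex set" where
  "tree_prefix a i = (\<Union>k\<in>{1..i}. insert (X k) (legs k (a k)))"

lemma finite_legs [simp]: "finite (legs i n)"
  by (simp add: legs_def)

lemma legs_0 [simp]: "legs i 0 = {}"
  by (simp add: legs_def)

lemma legs_Suc: "legs i (Suc n) = legs i n \<union> {Y i (Suc n), Z i (Suc n)}"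
  by (auto simp: legs_def atLeastAtMostSuc_conv)

lemma tree_prefix_0 [simp]: "tree_prefix a 0 = {}"
  by (simp add: tree_prefix_def)

lemma tree_prefix_Suc:
  "tree_prefix a (Suc i) = tree_prefix a i \<union> insert (X (Suc i)) (legs (Suc i) (a (Suc i)))"
  by (auto simp: tree_prefix_def atLeastAtMostSuc_conv)

lemma pverts_T: "pverts (T m a) = tree_prefix a m"
  by (auto simp: T_def tree_prefix_def legs_def)

context
  fixes m :: nat and a :: "nat \<Rightarrow> nat" and N :: "tvertex \<Rightarrow> tvertex \<Rightarrow> real"
  assumes m: "m \<ge> 2"
  defines "N \<equiv> random_walk_laplacian (T m a)"
begin

lemma N_diag:
  assumes "v \<in> pverts (T m a)"
  shows "N v v = 1"
  unfolding N_def
proof (rule random_walk_laplacian_diag)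
  show "(v, v) \<notin> parcs (T m a)" by (auto simp: T_def T_edges_def)
  show "degree (T m a) v > 0" using T_no_isolated[OF m assms] .
qed

lemma N_nonadjacent:
  assumes "(u, v) \<notin> parcs (T m a)" "u \<noteq> v"
  shows "N u v = 0" "N v u = 0"
proof -
  have "(v, u) \<notin> parcs (T m a)" using assms(1) by (auto simp: T_def)
  then show "N u v = 0" "N v u = 0"
    using assms by (auto simp: N_def random_walk_laplacian_nonadjacent)
qed

lemma N_edge:
  assumes "(u, v) \<in> T_edges m a"
  shows "N u v * N v u = 1 / (real (degree (T m a) u) * real (degree (T m a) v))"
proof -
  have "u \<noteq> v" using assms by (auto simp: T_edges_def)
  moreover have "(u, v) \<in> parcs (T m a)" "(v, u) \<in> parcs (T m a)"
    using assms by (auto simp: T_def)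
  ultimately show ?thesis by (simp add: N_def random_walk_laplacian_arc)
qed

lemma permanent_leg:
  assumes "i \<in> {1..m}" "j \<in> {1..a i}"
  shows "permanent {Y i j, Z i j} N = 3 / 2"
proof -
  have "permanent ({Y i j} \<union> {Z i j}) N = N (Y i j) (Y i j) * N (Z i j) (Z i j)
      + N (Y i j) (Z i j) * N (Z i j) (Y i j)"
    by (subst permanent_cut_edge[of _ _ "Y i j" "Z i j"]) auto
  moreover have "N (Y i j) (Y i j) = 1" "N (Z i j) (Z i j) = 1"
    using assms by (auto intro!: N_diag simp: T_def)
  moreover have "N (Y i j) (Z i j) * N (Z i j) (Y i j) = 1 / 2"
    using assms by (subst N_edge) (auto simp: T_edges_def degree_T_Y degree_T_Z)
  ultimately show ?thesis by (simp add: insert_commute)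
qed

lemma permanent_legs:
  assumes "i \<in> {1..m}" "n \<le> a i"
  shows "permanent (legs i n) N = (3 / 2) ^ n"
  using assms(2)
proof (induction n)
  case 0
  then show ?case by simp
next
  case (Suc n)
  have "permanent (legs i (Suc n)) N
      = permanent (legs i n) N * permanent {Y i (Suc n), Z i (Suc n)} N"
    unfolding legs_Suc
  proof (rule permanent_disjoint_blocks)
    show "N u v = 0" if "u \<in> legs i n" "v \<in> {Y i (Suc n), Z i (Suc n)}" for u v
      using that by (intro N_nonadjacent) (auto simp: legs_def T_def T_edges_def)
  qed (auto simp: legs_def)
  then show ?case
    using Suc assms(1) by (simp add: permanent_leg)
qed

text \<open>
  The summand \<open>n / (3 * d)\<close> counts the choices of a leg whose inner vertex is swapped with
  \<open>X i\<close>: the weight \<open>1 / (2 * d)\<close> of the joining edge replaces the factor \<open>3/2\<close> of that leg.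
\<close>

lemma permanent_spider:
  assumes i: "i \<in> {1..m}" and "n \<le> a i"
  shows "permanent (insert (X i) (legs i n)) N
    = (3 / 2) ^ n * (1 + real n / (3 * real (degree (T m a) (X i))))"
  using assms(2)
proof (induction n)
  case 0
  show ?case using i by (simp add: N_diag T_def)
next
  case (Suc n)
  let ?A = "insert (X i) (legs i n)" and ?B = "{Y i (Suc n), Z i (Suc n)}"
  let ?d = "real (degree (T m a) (X i))"
  have "?d > 0" using degree_T_X[OF m i] by simp
  have "permanent (insert (X i) (legs i (Suc n))) N = permanent (?A \<union> ?B) N"
    by (simp only: legs_Suc Un_insert_left)
  also have "\<dots> = permanent ?A N * permanent ?B N
      + N (X i) (Y i (Suc n)) * N (Y i (Suc n)) (X i)
        * (permanent (?A - {X i}) N * permanent (?B - {Y i (Suc n)}) N)"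
  proof (rule permanent_cut_edge)
    show "N u v = 0 \<and> N v u = 0"
      if "u \<in> ?A" "v \<in> ?B" "(u, v) \<noteq> (X i, Y i (Suc n))" for u v
      using that by (intro conjI N_nonadjacent) (auto simp: legs_def T_def T_edges_def)
  qed (auto simp: legs_def)
  also have "?A - {X i} = legs i n" by (auto simp: legs_def)
  also have "permanent (legs i n) N = (3 / 2) ^ n"
    using Suc i by (intro permanent_legs) auto
  also have "?B - {Y i (Suc n)} = {Z i (Suc n)}" by auto
  also have "permanent {Z i (Suc n)} N = 1"
    using Suc i by (auto intro!: N_diag simp: T_def)
  also have "permanent ?B N = 3 / 2"
    using Suc i by (intro permanent_leg) auto
  also have "N (X i) (Y i (Suc n)) * N (Y i (Suc n)) (X i) = 1 / (?d * 2)"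
    using Suc i by (subst N_edge) (auto simp: T_edges_def degree_T_Y)
  also have "permanent ?A N = (3 / 2) ^ n * (1 + real n / (3 * ?d))"
    using Suc by simp
  finally show ?case
    using \<open>?d > 0\<close> by (simp add: field_simps)
qed

text \<open>
  Without \<open>X (Suc i)\<close> the legs of this vertex are disconnected from the tree up to \<open>X i\<close>, which
  is why the second summand goes back two steps.
\<close>

lemma permanent_tree_prefix_rec:
  assumes "Suc (Suc i) \<le> m"
  defines "d \<equiv> \<lambda>k. real (degree (T m a) (X k))"
  shows "permanent (tree_prefix a (Suc (Suc i))) N
    = permanent (tree_prefix a (Suc i)) N
        * ((3 / 2) ^ a (Suc (Suc i)) * (1 + real (a (Suc (Suc i))) / (3 * d (Suc (Suc i)))))
      + 1 / (d (Suc i) * d (Suc (Suc i)))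
        * (permanent (tree_prefix a i) N * (3 / 2) ^ a (Suc i) * (3 / 2) ^ a (Suc (Suc i)))"
proof -
  let ?k = "Suc i" and ?l = "Suc (Suc i)"
  let ?A = "tree_prefix a ?k" and ?B = "insert (X ?l) (legs ?l (a ?l))"
  have "permanent (tree_prefix a ?l) N = permanent (?A \<union> ?B) N"
    by (simp only: tree_prefix_Suc[of a "Suc i"])
  also have "\<dots> = permanent ?A N * permanent ?B N
      + N (X ?k) (X ?l) * N (X ?l) (X ?k)
        * (permanent (?A - {X ?k}) N * permanent (?B - {X ?l}) N)"
  proof (rule permanent_cut_edge)
    show "N u v = 0 \<and> N v u = 0"
      if "u \<in> ?A" "v \<in> ?B" "(u, v) \<noteq> (X ?k, X ?l)" for u v
      using that
      by (intro conjI N_nonadjacent) (auto simp: tree_prefix_def legs_def T_def T_edges_def)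
  qed (auto simp: tree_prefix_def legs_def)
  also have "?A - {X ?k} = tree_prefix a i \<union> legs ?k (a ?k)"
    by (auto simp: tree_prefix_Suc) (auto simp: tree_prefix_def legs_def)
  also have "permanent \<dots> N = permanent (tree_prefix a i) N * permanent (legs ?k (a ?k)) N"
  proof (rule permanent_disjoint_blocks)
    show "N u v = 0" if "u \<in> tree_prefix a i" "v \<in> legs ?k (a ?k)" for u v
      using that by (intro N_nonadjacent) (auto simp: tree_prefix_def legs_def T_def T_edges_def)
  qed (auto simp: tree_prefix_def legs_def)
  also have "permanent (legs ?k (a ?k)) N = (3 / 2) ^ a ?k"
    using assms(1) by (intro permanent_legs) auto
  also have "?B - {X ?l} = legs ?l (a ?l)" by (auto simp: legs_def)
  also have "permanent (legs ?l (a ?l)) N = (3 / 2) ^ a ?l"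
    using assms(1) by (intro permanent_legs) auto
  also have "permanent ?B N = (3 / 2) ^ a ?l * (1 + real (a ?l) / (3 * d ?l))"
    unfolding d_def using assms(1) by (intro permanent_spider) auto
  also have "N (X ?k) (X ?l) * N (X ?l) (X ?k) = 1 / (d ?k * d ?l)"
    unfolding d_def using assms(1) by (intro N_edge) (auto simp: T_edges_def)
  finally show ?thesis .
qed

end

theorem proposition2p2:
  fixes m :: nat and a d :: "nat \<Rightarrow> nat" and f :: "nat \<Rightarrow> real"
  assumes "m \<ge> 2"
    and "\<And>i. i \<in> {1..m} \<Longrightarrow> d i = degree (T m a) (X i)"
    and "f 0 = 1"
    and "f 1 = 1 + real (a 1) / (3 * real (d 1))"
    and "\<And>i. i \<in> {2..m} \<Longrightarrow>
           f i = (1 + real (a i) / (3 * real (d i))) * f (i - 1)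
                 + 1 / (real (d (i - 1)) * real (d i)) * f (i - 2)"
  shows "laplacian_ratio (T m a) = (3 / 2) ^ (\<Sum>i = 1..m. a i) * f m"
proof -
  let ?N = "random_walk_laplacian (T m a)"
  have "permanent (tree_prefix a i) ?N = (3 / 2) ^ (\<Sum>k = 1..i. a k) * f i" if "i \<le> m" for i
    using that
  proof (induction i rule: induct_nat_012)
    case 0
    show ?case using assms(3) by simp
  next
    case 1
    have "tree_prefix a 1 = insert (X 1) (legs 1 (a 1))"
      using tree_prefix_Suc[of a 0] by simp
    then show ?case
      using permanent_spider[OF assms(1), of 1 "a 1" a] assms(1,2,4) by simp
  next
    case (ge2 i)
    let ?k = "Suc i" and ?l = "Suc (Suc i)"
    have f: "f ?l = (1 + real (a ?l) / (3 * real (d ?l))) * f ?k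
        + 1 / (real (d ?k) * real (d ?l)) * f i"
      using assms(5)[of ?l] ge2.prems by simp
    have d: "degree (T m a) (X ?k) = d ?k" "degree (T m a) (X ?l) = d ?l"
      using assms(2) ge2.prems by auto
    show ?case
      using permanent_tree_prefix_rec[OF assms(1) ge2.prems] ge2
      by (simp add: d f power_add algebra_simps)
  qed
  then show ?thesis
    by (simp add: laplacian_ratio_eq_permanent pverts_T)
qed

end
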